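(* For $k\ge 1$ let $a_k$ denote the number of natural exact covering systems (NECS) consisting of exactly $k$ congruences, and define the formal power series $A(x)=\sum_{k\ge 1}a_k x^k$ and $M(x)=\sum_{k\ge 1}\mu(k)x^k$, where $\mu$ is the number-theoretic M\"obius function. Then $A(x)$ is the unique formal power series solution to the functional equation \[ M(A(x)) = x \] with initial condition $A(0)=0$.
   Context: For integers $n\ge 1$ and $0\le a<n$, let $\langle a,n\rangle=\{x\in\mathbb Z: x\equiv a \pmod n\}$. An exact covering system (ECS) is a finite set $C=\{\langle a_i,n_i\rangle : i=1,\dots,k\}$ of $k\ge1$ pairwise disjoint residue classes whose union is $\mathbb Z$; its size is $|C|=k$. For an ECS $C$, a class $\langle a,n\rangle\in C$ and an integer $r\ge 2$, an $r$-split of $C$ is the ECS obtained by removing $\langle a,n\rangle$ from $C$ and replacing it by the $r$ classes $\langle a+jn, rn\rangle$, $j=0,1,\dots,r-1$. A natural exact covering system (NECS) is an ECS that can be obtained from $\{\langle 0,1\rangle\}=\{\mathbb Z\}$ by a finite (possibly empty) sequence of splits, where the value of $r\ge 2$ may vary from split to split. NECS are counted as sets of residue classes (different split sequences giving the same set of classes count once). *)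

theory Defs
  imports "HOL-Computational_Algebra.Computational_Algebra" "HOL-Library.Disjoint_Sets"
begin

definition res_class :: "int \<Rightarrow> int \<Rightarrow> int set" where
  "res_class a n = {x. x mod n = a mod n}"

definition ECS :: "int set set \<Rightarrow> bool" where
  "ECS C \<longleftrightarrow> finite C \<and> C \<noteq> {} \<and>
     (\<forall>c\<in>C. \<exists>a n. 1 \<le> n \<and> 0 \<le> a \<and> a < n \<and> c = res_class a n) \<and>
     disjoint C \<and> \<Union>C = UNIV"

definition split_at :: "int set set \<Rightarrow> int \<Rightarrow> int \<Rightarrow> int \<Rightarrow> int set set" where
  "split_at C a n r = (C - {res_class a n}) \<union> (\<lambda>j. res_class (a + j * n) (r * n)) ` {0..<r}"

definition is_split :: "int set set \<Rightarrow> int set set \<Rightarrow> bool" where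
  "is_split C C' \<longleftrightarrow> ECS C \<and>
     (\<exists>a n r. 1 \<le> n \<and> 0 \<le> a \<and> a < n \<and> res_class a n \<in> C \<and> 2 \<le> r \<and> C' = split_at C a n r)"

definition NECS :: "int set set \<Rightarrow> bool" where
  "NECS C \<longleftrightarrow> ECS C \<and> is_split\<^sup>*\<^sup>* {res_class 0 1} C"

definition num_NECS :: "nat \<Rightarrow> nat" where
  "num_NECS k = card {C. NECS C \<and> card C = k}"

definition moebius_mu :: "nat \<Rightarrow> int" where
  "moebius_mu n = (if squarefree n then (-1) ^ card (prime_factors n) else 0)"

definition A_fps :: "'a::comm_ring_1 fps" where
  "A_fps = Abs_fps (\<lambda>k. if k = 0 then 0 else of_nat (num_NECS k))"

definition M_fps :: "'a::comm_ring_1 fps" where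
  "M_fps = Abs_fps (\<lambda>k. if k = 0 then 0 else of_int (moebius_mu k))"

lemma res_class_inject:
  assumes "1 \<le> n" "0 \<le> a" "a < n" "1 \<le> n'" "0 \<le> a'" "a' < n'"
    and eq: "res_class a n = res_class a' n'"
  shows "a = a' \<and> n = n'"
proof -
  have dvd: "n' dvd n" if "res_class a n = res_class a' n'" for a a' n n'
  proof -
    have "a \<in> res_class a' n'" "a + n \<in> res_class a' n'"
      unfolding that[symmetric] by (auto simp: res_class_def)
    then have "(a + n) mod n' = a mod n'" by (simp add: res_class_def)
    then show ?thesis by (metis add_diff_cancel_left' mod_eq_dvd_iff)
  qed
  have n: "n = n'"
    using dvd[OF eq] dvd[OF eq[symmetric]] assms by (simp add: zdvd_antisym_nonneg)
  have "a \<in> res_class a' n'" unfolding eq[symmetric] by (simp add: res_class_def)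
  then show ?thesis using n assms by (simp add: res_class_def)
qed

lemma is_split_ECS_card:
  assumes "is_split C C'"
  obtains a n r where "1 \<le> n" "0 \<le> a" "a < n" "res_class a n \<in> C" "2 \<le> r"
    "C' = split_at C a n r" "ECS C'" "card C < card C'" "r \<le> int (card C')"
proof -
  from assms obtain a n r where E: "ECS C" and n: "1 \<le> n" and a: "0 \<le> a" "a < n"
    and in_C: "res_class a n \<in> C" and r: "2 \<le> r" and C': "C' = split_at C a n r"
    by (auto simp: is_split_def)
  define f where "f = (\<lambda>j. res_class (a + j * n) (r * n))"
  have range: "1 \<le> r * n \<and> 0 \<le> a + j * n \<and> a + j * n < r * n" if "j \<in> {0..<r}" for j
  proof -
    have "(j + 1) * n \<le> r * n" using that n by (intro mult_right_mono) auto
    moreover have "1 * 1 \<le> r * n" using r n by (intro mult_mono) auto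
    ultimately show ?thesis using that n a by (auto simp: algebra_simps)
  qed
  have inj: "inj_on f {0..<r}"
  proof (rule inj_onI)
    fix i j assume *: "i \<in> {0..<r}" "j \<in> {0..<r}" "f i = f j"
    have "a + i * n = a + j * n"
      using res_class_inject[of "r * n" "a + i * n" "r * n" "a + j * n"] range[of i] range[of j] *
      by (auto simp: f_def)
    then show "i = j" using n by simp
  qed
  have U: "\<Union>(f ` {0..<r}) = res_class a n"
  proof (intro equalityI subsetI)
    fix x assume "x \<in> \<Union>(f ` {0..<r})"
    then obtain j where "x mod (r * n) = (a + j * n) mod (r * n)"
      by (auto simp: f_def res_class_def)
    then have "x mod (r * n) mod n = (a + j * n) mod (r * n) mod n" by simp
    then show "x \<in> res_class a n" by (simp add: res_class_def mod_mod_cancel)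
  next
    fix x assume "x \<in> res_class a n"
    then have "n dvd x - a" by (simp add: res_class_def mod_eq_dvd_iff)
    then obtain q where q: "x - a = n * q" ..
    have "x - (a + (q mod r) * n) = (q - q mod r) * n" using q by (simp add: algebra_simps)
    also have "\<dots> = (r * (q div r)) * n" by (simp add: minus_mod_eq_mult_div)
    finally have "r * n dvd x - (a + (q mod r) * n)" by simp
    then have "x \<in> f (q mod r)" by (simp add: f_def res_class_def mod_eq_dvd_iff)
    moreover have "q mod r \<in> {0..<r}" using r by simp
    ultimately show "x \<in> \<Union>(f ` {0..<r})" by blast
  qed
  have ne: "f j \<noteq> {}" for j by (auto simp: f_def res_class_def)
  have disj_f: "f i \<inter> f j = {}" if "i \<in> {0..<r}" "j \<in> {0..<r}" "i \<noteq> j" for i j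
  proof (rule ccontr)
    assume "f i \<inter> f j \<noteq> {}"
    then have "f i = f j" by (auto simp: f_def res_class_def)
    with inj that show False by (auto dest: inj_onD)
  qed
  have disj: "c \<inter> f j = {}" if "c \<in> C - {res_class a n}" "j \<in> {0..<r}" for c j
  proof -
    have "c \<inter> res_class a n = {}"
      using E in_C that disjointD[of C c "res_class a n"] unfolding ECS_def by blast
    moreover have "f j \<subseteq> res_class a n" using U that by blast
    ultimately show ?thesis by blast
  qed
  have new: "(C - {res_class a n}) \<inter> f ` {0..<r} = {}"
    using disj ne by fastforce
  have C'2: "C' = (C - {res_class a n}) \<union> f ` {0..<r}" by (simp add: C' split_at_def f_def)
  have fin: "finite C" using E by (simp add: ECS_def)
  have "card C' = card (C - {res_class a n}) + card (f ` {0..<r})"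
    unfolding C'2 using new fin by (intro card_Un_disjoint) auto
  also have "\<dots> = (card C - 1) + nat r"
    using in_C inj by (simp add: card_image)
  finally have card: "card C' = (card C - 1) + nat r" .
  have "card C \<ge> 1" using in_C fin card_gt_0_iff[of C] by fastforce
  then have c: "card C < card C'" "r \<le> int (card C')" using card r by auto
  have "\<exists>a n. 1 \<le> n \<and> 0 \<le> a \<and> a < n \<and> c = res_class a n" if "c \<in> C'" for c
  proof (cases "c \<in> C")
    case True
    then show ?thesis using E by (simp add: ECS_def)
  next
    case False
    then show ?thesis using that range unfolding C'2 f_def by blast
  qed
  moreover have "disjoint C'"
    unfolding C'2
  proof (rule disjointI)
    fix x y assume xy: "x \<in> C - {res_class a n} \<union> f ` {0..<r}"
      "y \<in> C - {res_class a n} \<union> f ` {0..<r}" "x \<noteq> y"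
    have "x \<inter> y = {}" if "x \<in> C" "y \<in> C"
      using E that xy(3) disjointD[of C x y] unfolding ECS_def by blast
    with xy disj disj_f show "x \<inter> y = {}" by blast
  qed
  moreover have "\<Union>C' = UNIV"
  proof -
    have "\<Union>C' = \<Union>(C - {res_class a n}) \<union> res_class a n" using U by (simp add: C'2)
    also have "\<dots> = \<Union>C" using in_C by blast
    finally show ?thesis using E by (simp add: ECS_def)
  qed
  ultimately have "ECS C'" using fin C'2 r by (auto simp: ECS_def)
  with c show ?thesis using that n a in_C r C' by blast
qed

text \<open>There are only finitely many NECS of each size, so \<open>num_NECS\<close> is a genuine count.\<close>

lemma finite_NECS: "finite {C. NECS C \<and> card C \<le> k}"
proof (induction k)
  case 0
  have *: "{C. NECS C \<and> card C \<le> 0} = {}" by (auto simp: NECS_def ECS_def)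
  show ?case unfolding * by simp
next
  case (Suc k)
  define S where "S = {C. NECS C \<and> card C \<le> k}"
  define P where "P c = {(a, n). 1 \<le> n \<and> 0 \<le> a \<and> a < n \<and> c = res_class a n}" for c
  have P: "finite (P c)" for c
  proof (cases "P c = {}")
    case False
    then obtain p where p: "p \<in> P c" by blast
    have "q = p" if "q \<in> P c" for q
      using p that res_class_inject[of "snd p" "fst p" "snd q" "fst q"]
      by (simp add: P_def case_prod_beta prod_eq_iff)
    then have "P c \<subseteq> {p}" by blast
    then show ?thesis using finite_subset by blast
  qed simp
  define T where "T = insert {res_class 0 1}
    (\<Union>C\<in>S. \<Union>c\<in>C. \<Union>(a, n)\<in>P c. split_at C a n ` {0..int (Suc k)})"
  have "finite T"
  proof -
    have "finite S" using Suc by (simp add: S_def)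
    moreover have "finite C" if "C \<in> S" for C
      using that by (simp add: S_def NECS_def ECS_def)
    ultimately show ?thesis unfolding T_def using P
      by (intro finite.insertI finite_UN_I) (auto intro: finite_imageI)
  qed
  moreover have "{C. NECS C \<and> card C \<le> Suc k} \<subseteq> T"
  proof
    fix C assume "C \<in> {C. NECS C \<and> card C \<le> Suc k}"
    then have le: "card C \<le> Suc k" and "is_split\<^sup>*\<^sup>* {res_class 0 1} C"
      by (auto simp: NECS_def)
    from this(2) show "C \<in> T"
    proof (cases rule: rtranclp.cases)
      case rtrancl_refl
      then show ?thesis by (simp add: T_def)
    next
      case (rtrancl_into_rtrancl B)
      obtain a n r where *: "1 \<le> n" "0 \<le> a" "a < n" "res_class a n \<in> B" "2 \<le> r"
        "C = split_at B a n r" "card B < card C" "r \<le> int (card C)"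
        by (rule is_split_ECS_card[OF rtrancl_into_rtrancl(2)])
      have "B \<in> S"
      proof -
        have "ECS B" using rtrancl_into_rtrancl(2) by (simp add: is_split_def)
        then show ?thesis using rtrancl_into_rtrancl(1) *(7) le by (simp add: S_def NECS_def)
      qed
      moreover have "(a, n) \<in> P (res_class a n)" using * by (simp add: P_def)
      moreover have "r \<in> {0..int (Suc k)}" using * le by auto
      ultimately show ?thesis
        unfolding T_def *(6) using *(4)
        by (intro insertI2 UN_I[of B] UN_I[of "res_class a n"] UN_I[of "(a, n)"]) simp_all
    qed
  qed
  ultimately show ?case using finite_subset by blast
qed

end

theory Submission
  imports Defs
begin

text \<open>A natural system other than \<open>{\<int>}\<close> is a copy of \<open>r \<ge> 2\<close> natural systems, one in each class
  modulo \<open>r\<close>; the systems that arise so from a given \<open>r\<close> are counted by \<open>A(x)\<^sup>r\<close>. A natural system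
  \<open>C\<close> arises from \<open>r\<close> if and only if \<open>r\<close> divides the gcd \<open>g\<close> of its moduli, and \<open>g = 1\<close> only for
  \<open>C = {\<int>}\<close>. Hence \<open>\<Sum>\<^sub>r \<mu>(r) A(x)\<^sup>r = \<Sum>\<^sub>C x\<^bsup>|C|\<^esup> \<Sum>\<^bsub>r dvd g\<^esub> \<mu>(r) = x\<close>. For uniqueness, the lowest
  coefficient in which \<open>F\<close> and \<open>G\<close> differ is also one in which \<open>M(F)\<close> and \<open>M(G)\<close> differ.\<close>

section \<open>Interleaving systems of residue classes\<close>

definition rescale :: "int \<Rightarrow> int \<Rightarrow> int set set \<Rightarrow> int set set" where
  "rescale a n C = (\<lambda>c. (\<lambda>x. a + n * x) ` c) ` C"

text \<open>Part \<open>f j\<close> sits inside the class of \<open>j\<close> modulo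
  \<open>r\<close>. Values of \<open>f\<close> from \<open>r\<close> on are ignored, which is why
  the tuples counted later are taken extensional.\<close>

definition interleave :: "nat \<Rightarrow> (nat \<Rightarrow> int set set) \<Rightarrow> int set set" where
  "interleave r f = (\<Union>j<r. rescale (int j) (int r) (f j))"

lemma res_class_eq_range: "res_class a n = range (\<lambda>x. a + n * x)"
proof (intro set_eqI iffI)
  fix y assume "y \<in> res_class a n"
  then have "n dvd y - a" by (simp add: res_class_def mod_eq_dvd_iff)
  then obtain k where "y - a = n * k" ..
  then have "y = a + n * k" by simp
  then show "y \<in> range (\<lambda>x. a + n * x)" by blast
next
  fix y assume "y \<in> range (\<lambda>x. a + n * x)"
  then show "y \<in> res_class a n" by (auto simp: res_class_def)
qed

lemma image_res_class: "(\<lambda>x. b + m * x) ` res_class a n = res_class (b + m * a) (m * n)"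
  by (simp add: res_class_eq_range image_image algebra_simps)

lemma res_class_0_1: "res_class 0 1 = UNIV"
  by (auto simp: res_class_def)

lemma rescale_rescale: "rescale a n (rescale b m C) = rescale (a + n * b) (n * m) C"
  by (simp add: rescale_def image_image algebra_simps)

lemma rescale_0_1: "rescale 0 1 C = C"
  by (simp add: rescale_def)

lemma rescale_UNION: "rescale a n (\<Union>i\<in>I. F i) = (\<Union>i\<in>I. rescale a n (F i))"
  by (auto simp: rescale_def)

lemma interleave_1: "interleave 1 f = f 0"
  by (simp add: interleave_def rescale_0_1 lessThan_Suc)

lemma interleave_cong: "(\<And>j. j < r \<Longrightarrow> f j = g j) \<Longrightarrow> interleave r f = interleave r g"
  by (simp add: interleave_def)

text \<open>The affine maps compose to x -> (j + s i) + s t x, and j + s i runs once through the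
  numbers below s t, with j and i recovered as remainder and quotient by s. From left to right the
  rule merges two levels; from right to left it regroups one level.\<close>

lemma interleave_interleave:
  assumes "s > 0"
  shows "interleave s (\<lambda>j. interleave t (h j)) = interleave (s * t) (\<lambda>m. h (m mod s) (m div s))"
proof -
  have "interleave s (\<lambda>j. interleave t (h j)) =
      (\<Union>j<s. \<Union>i<t. rescale (int (j + s * i)) (int (s * t)) (h j i))"
    by (simp add: interleave_def rescale_UNION rescale_rescale)
  also have "\<dots> = (\<Union>m<s * t. rescale (int m) (int (s * t)) (h (m mod s) (m div s)))"
  proof (intro equalityI subsetI)
    fix c assume "c \<in> (\<Union>j<s. \<Union>i<t. rescale (int (j + s * i)) (int (s * t)) (h j i))"
    then obtain j i where *: "j < s" "i < t" "c \<in> rescale (int (j + s * i)) (int (s * t)) (h j i)"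
      by blast
    have "j + s * i < s * Suc i" using * by simp
    also have "\<dots> \<le> s * t" using * by (intro mult_le_mono2) simp
    finally have "j + s * i < s * t" .
    then show "c \<in> (\<Union>m<s * t. rescale (int m) (int (s * t)) (h (m mod s) (m div s)))"
      using * by (intro UN_I[of "j + s * i"]) auto
  next
    fix c assume "c \<in> (\<Union>m<s * t. rescale (int m) (int (s * t)) (h (m mod s) (m div s)))"
    then obtain m where *: "m < s * t" "c \<in> rescale (int m) (int (s * t)) (h (m mod s) (m div s))"
      by blast
    have "m div s < t" using *(1) by (simp add: less_mult_imp_div_less mult.commute)
    moreover have "m mod s < s" using assms by simp
    ultimately show "c \<in> (\<Union>j<s. \<Union>i<t. rescale (int (j + s * i)) (int (s * t)) (h j i))"
      using *(2) by (intro UN_I[of "m mod s"] UN_I[of "m div s"]) auto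
  qed
  finally show ?thesis by (simp add: interleave_def)
qed

text \<open>All elements of the image have residue \<open>j\<close> modulo \<open>r\<close>, so a
  nonempty image reveals \<open>j\<close>; the injective affine map can then be cancelled. The empty
  set would sit in every part at once.\<close>

lemma affine_image_eqD:
  assumes "j < r" "k < r" "c \<noteq> {}"
    and eq: "(\<lambda>x. int j + int r * x) ` c = (\<lambda>x. int k + int r * x) ` c'"
  shows "j = k \<and> c = c'"
proof -
  obtain x where "x \<in> c" using assms(3) by blast
  then obtain y where "int j + int r * x = int k + int r * y" using eq by blast
  then have "(int j + int r * x) mod int r = (int k + int r * y) mod int r" by simp
  then have jk: "j = k" using assms(1,2) by simp
  moreover have "inj (\<lambda>x. int j + int r * x)" using assms(1) by (auto simp: inj_on_def)
  ultimately show ?thesis using eq by (simp add: inj_image_eq_iff)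
qed

lemma interleave_inject:
  assumes "\<And>j. j < r \<Longrightarrow> {} \<notin> f j" "\<And>j. j < r \<Longrightarrow> {} \<notin> g j"
    and eq: "interleave r f = interleave r g" and j: "j < r"
  shows "f j = g j"
proof -
  have sub: "f j \<subseteq> g j"
    if "\<And>j. j < r \<Longrightarrow> {} \<notin> f j" "interleave r f = interleave r g" for f g
  proof
    fix c assume c: "c \<in> f j"
    then have "(\<lambda>x. int j + int r * x) ` c \<in> interleave r g"
      unfolding that(2)[symmetric] using j by (auto simp: interleave_def rescale_def)
    then obtain k c' where "k < r" "c' \<in> g k"
        "(\<lambda>x. int j + int r * x) ` c = (\<lambda>x. int k + int r * x) ` c'"
      by (auto simp: interleave_def rescale_def)
    then show "c \<in> g j" using affine_image_eqD[OF j, of k c c'] c that(1)[OF j] by metis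
  qed
  show ?thesis using sub[of f g] sub[of g f] assms by auto
qed

text \<open>Affine transport keeps representatives normalised, so \<open>res_class_inject\<close>
  applies to transported classes.\<close>

lemma affine_bounds:
  assumes "j < r" "0 \<le> a" "a < n"
  shows "1 \<le> int r * n" "int j + int r * a < int r * n"
proof -
  have "int j + int r * a < int r * (a + 1)" using assms by (simp add: algebra_simps)
  also have "\<dots> \<le> int r * n" using assms by (intro mult_left_mono) auto
  finally show "int j + int r * a < int r * n" .
  moreover have "0 \<le> int j + int r * a" using assms by simp
  ultimately show "1 \<le> int r * n" by linarith
qed

lemma card_interleave:
  assumes "\<And>j. j < r \<Longrightarrow> {} \<notin> f j" "\<And>j. j < r \<Longrightarrow> finite (f j)"
  shows "card (interleave r f) = (\<Sum>j<r. card (f j))"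
proof -
  have "card (interleave r f) = (\<Sum>j<r. card (rescale (int j) (int r) (f j)))"
    unfolding interleave_def
  proof (intro card_UN_disjoint ballI impI)
    fix i j assume *: "i \<in> {..<r}" "j \<in> {..<r}" "i \<noteq> j"
    have False if "c \<in> f i" "(\<lambda>x. int i + int r * x) ` c = (\<lambda>x. int j + int r * x) ` d" for c d
      using affine_image_eqD[of i r j c d] that assms(1)[of i] * by auto
    then show "rescale (int i) (int r) (f i) \<inter> rescale (int j) (int r) (f j) = {}"
      unfolding rescale_def by blast
  qed (use assms in \<open>auto simp: rescale_def\<close>)
  also have "\<dots> = (\<Sum>j<r. card (f j))"
  proof (intro sum.cong refl)
    fix j assume j: "j \<in> {..<r}"
    then have "inj_on (\<lambda>c. (\<lambda>x. int j + int r * x) ` c) (f j)"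
      using affine_image_eqD[of j r j] assms(1)[of j] by (metis inj_onI lessThan_iff)
    then show "card (rescale (int j) (int r) (f j)) = card (f j)"
      by (simp add: rescale_def card_image)
  qed
  finally show ?thesis .
qed

lemma split_at_UNIV: "split_at {UNIV} 0 1 (int r) = interleave r (\<lambda>_. {UNIV})"
proof -
  have "{0..<int r} = int ` {..<r}" by (simp add: image_int_atLeastLessThan lessThan_atLeast0)
  then have "split_at {UNIV} 0 1 (int r) = (\<lambda>j. res_class (int j) (int r)) ` {..<r}"
    by (simp add: split_at_def res_class_0_1 image_image)
  then show ?thesis by (auto simp: interleave_def rescale_def res_class_eq_range)
qed

text \<open>Splitting commutes with affine maps, and a class transported into part \<open>j\<close>
  occurs in no other part, so the split takes place entirely inside part \<open>j\<close>.\<close>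

lemma split_at_interleave:
  assumes j: "j < r"
  shows "split_at (interleave r f) (int j + int r * a) (int r * n) q
       = interleave r (f(j := split_at (f j) a n q))"
proof -
  define T where "T i c = (\<lambda>x. int i + int r * x) ` c" for i c
  define R where "R = (\<Union>i\<in>{..<r} - {j}. T i ` f i)"
  define S where "S = (\<lambda>i. res_class (a + i * n) (q * n)) ` {0..<q}"
  have T_eqD: "i = j \<and> c = res_class a n" if "i < r" "T i c = T j (res_class a n)" for i c
    using affine_image_eqD[OF j that(1), of "res_class a n" c] that(2)
    by (auto simp: T_def res_class_eq_range)
  have upd: "interleave r (f(j := D)) = R \<union> T j ` D" for D
    using j by (auto simp: interleave_def rescale_def R_def T_def split: if_splits)
  have "T j (res_class a n) \<notin> R"
    using T_eqD by (force simp: R_def)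
  moreover have "T j ` (f j - {res_class a n}) = T j ` f j - {T j (res_class a n)}"
    using T_eqD[OF j] by auto
  moreover have "T j (res_class a n) = res_class (int j + int r * a) (int r * n)"
    unfolding T_def by (rule image_res_class)
  moreover have "T j ` S =
      (\<lambda>i. res_class (int j + int r * a + i * (int r * n)) (q * (int r * n))) ` {0..<q}"
    unfolding T_def S_def image_image image_res_class by (simp add: algebra_simps)
  moreover have "interleave r f = R \<union> T j ` f j" using upd[of "f j"] by simp
  ultimately have "split_at (interleave r f) (int j + int r * a) (int r * n) q =
      R \<union> (T j ` (f j - {res_class a n}) \<union> T j ` S)"
    unfolding split_at_def by auto
  also have "\<dots> = R \<union> T j ` split_at (f j) a n q"
    by (simp add: split_at_def S_def image_Un)
  finally show ?thesis by (simp only: upd)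
qed

section \<open>Natural systems as iterated interleavings\<close>

text \<open>Here a system is built with its first split outermost, whereas \<open>NECS\<close>
  appends its last split at an arbitrary class. This form supports induction over the parts.\<close>

inductive natural :: "int set set \<Rightarrow> bool" where
  natural_UNIV: "natural {UNIV}"
| natural_interleave: "2 \<le> r \<Longrightarrow> (\<And>j. j < r \<Longrightarrow> natural (f j)) \<Longrightarrow> natural (interleave r f)"

lemma natural_interleave':
  assumes "1 \<le> r" "\<And>j. j < r \<Longrightarrow> natural (f j)"
  shows "natural (interleave r f)"
proof (cases "r = 1")
  case True
  then show ?thesis using assms(2)[of 0] interleave_1[of f] by simp
next
  case False
  then show ?thesis using assms by (intro natural_interleave) auto
qed

lemma natural_res_class:
  assumes "natural C" "c \<in> C"
  shows "\<exists>a n. 1 \<le> n \<and> 0 \<le> a \<and> a < n \<and> c = res_class a n"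
  using assms
proof (induction arbitrary: c)
  case natural_UNIV
  then show ?case by (intro exI[of _ 0] exI[of _ 1]) (auto simp: res_class_0_1)
next
  case (natural_interleave r f)
  then obtain j d where j: "j < r" and "d \<in> f j" and c: "c = (\<lambda>x. int j + int r * x) ` d"
    by (auto simp: interleave_def rescale_def)
  then obtain a n where *: "1 \<le> n" "0 \<le> a" "a < n" "d = res_class a n"
    using natural_interleave.IH by blast
  have "1 \<le> int r * n" "int j + int r * a < int r * n"
    using affine_bounds[of j r a n] j * by auto
  then show ?case using * c
    by (intro exI[of _ "int j + int r * a"] exI[of _ "int r * n"]) (simp add: image_res_class)
qed

text \<open>Either all of the integers is split, which gives an interleaving of copies of
  \<open>{UNIV}\<close>, or the split class lies in one part and the induction hypothesis applies
  there.\<close>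

lemma natural_split_at:
  assumes "natural C" "1 \<le> n" "0 \<le> a" "a < n" "res_class a n \<in> C" "2 \<le> q"
  shows "natural (split_at C a n q)"
  using assms
proof (induction arbitrary: a n)
  case natural_UNIV
  then have "res_class a n = res_class 0 1" by (simp add: res_class_0_1)
  then have an: "a = 0" "n = 1" using res_class_inject[of n a 1 0] natural_UNIV by auto
  then show ?case
    using split_at_UNIV[of "nat q"] natural_UNIV.prems unfolding an
    by (simp add: natural_interleave natural.natural_UNIV)
next
  case (natural_interleave r f)
  then obtain j d where j: "j < r" and d: "d \<in> f j"
      and c: "res_class a n = (\<lambda>x. int j + int r * x) ` d"
    by (auto simp: interleave_def rescale_def)
  then obtain b m where *: "1 \<le> m" "0 \<le> b" "b < m" "d = res_class b m"
    using natural_res_class[OF natural_interleave.hyps(2)] by blast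
  have "1 \<le> int r * m" "int j + int r * b < int r * m"
    using affine_bounds[of j r b m] j * by auto
  \<comment> \<open>Both pairs are normalised representations of one class, so they agree.\<close>
  then have an: "a = int j + int r * b" "n = int r * m"
    using res_class_inject[of n a "int r * m" "int j + int r * b"] natural_interleave.prems * c
    by (auto simp: image_res_class)
  have "natural (split_at (f j) b m q)"
    using natural_interleave.IH[OF j] * d natural_interleave.prems by blast
  then show ?case
    unfolding an split_at_interleave[OF j]
    using natural_interleave.hyps by (intro natural.natural_interleave) auto
qed

lemma NECS_imp_natural: "NECS C \<Longrightarrow> natural C"
proof -
  assume "NECS C"
  then have "is_split\<^sup>*\<^sup>* {res_class 0 1} C" by (simp add: NECS_def)
  then show "natural C"
  proof induction
    case base
    then show ?case by (simp add: res_class_0_1 natural_UNIV)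
  next
    case (step C D)
    then show ?case by (auto simp: is_split_def intro: natural_split_at)
  qed
qed

section \<open>Converse: nested interleavings arise from split sequences\<close>

lemma NECS_UNIV: "NECS {UNIV}"
  unfolding NECS_def ECS_def
  by (simp add: res_class_0_1) (metis res_class_0_1 zero_less_one order_refl)

lemma NECS_is_split: "NECS C \<Longrightarrow> is_split C D \<Longrightarrow> NECS D"
  using is_split_ECS_card[of C D] by (metis NECS_def rtranclp.rtrancl_into_rtrancl)

lemma is_split_interleave:
  assumes "ECS (interleave r f)" "j < r" "is_split (f j) D"
  shows "is_split (interleave r f) (interleave r (f(j := D)))"
proof -
  obtain a n q where *: "1 \<le> n" "0 \<le> a" "a < n" "res_class a n \<in> f j" "2 \<le> q"
      "D = split_at (f j) a n q"
    using assms(3) by (auto simp: is_split_def)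
  have "1 \<le> int r * n" "int j + int r * a < int r * n"
    using affine_bounds[of j r a n] assms(2) * by auto
  moreover have "res_class (int j + int r * a) (int r * n) \<in> interleave r f"
    using assms(2) *(4) image_res_class[of "int j" "int r" a n]
    by (auto simp: interleave_def rescale_def intro!: bexI[of _ j] image_eqI[of _ _ "res_class a n"])
  ultimately show ?thesis
    unfolding is_split_def *(6) split_at_interleave[OF assms(2), symmetric]
    using assms(1) *
    by (intro conjI exI[of _ "int j + int r * a"] exI[of _ "int r * n"] exI[of _ q]) auto
qed

text \<open>Splits of one part lift one by one to the whole. \<open>NECS\<close> of the whole is
  carried as the invariant because \<open>is_split\<close> demands an \<open>ECS\<close> at every
  stage.\<close>

lemma NECS_interleave_splits:
  assumes "is_split\<^sup>*\<^sup>* B D" "j < r" "NECS (interleave r (f(j := B)))"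
  shows "NECS (interleave r (f(j := D)))"
  using assms(1)
proof induction
  case base
  then show ?case using assms(3) .
next
  case (step C D)
  have "is_split (interleave r (f(j := C))) (interleave r ((f(j := C))(j := D)))"
    using step assms(2)
    by (intro is_split_interleave) (simp_all only: NECS_def fun_upd_same)
  then show ?case using NECS_is_split[OF step.IH] by (simp only: fun_upd_upd)
qed

lemma NECS_interleave:
  assumes "2 \<le> r" "\<And>j. j < r \<Longrightarrow> NECS (f j)"
  shows "NECS (interleave r f)"
proof -
  \<comment> \<open>The parts are completed one after another: the first \<open>m\<close> are final
    and the others are still \<open>{UNIV}\<close>. For \<open>m = 0\<close> this is the
    \<open>r\<close>-split of the integers.\<close>
  have "NECS (interleave r (\<lambda>i. if i < m then f i else {UNIV}))" if "m \<le> r" for m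
    using that
  proof (induction m)
    case 0
    have "is_split {UNIV} (split_at {UNIV} 0 1 (int r))"
      unfolding is_split_def using NECS_UNIV assms(1)
      by (intro conjI exI[of _ 0] exI[of _ 1] exI[of _ "int r"])
        (auto simp: NECS_def res_class_0_1)
    then have "NECS (interleave r (\<lambda>_. {UNIV}))"
      using NECS_UNIV NECS_is_split by (simp add: split_at_UNIV)
    then show ?case by simp
  next
    case (Suc m)
    let ?g = "\<lambda>i. if i < m then f i else {UNIV}"
    have "?g(m := {UNIV}) = ?g" by (rule ext) simp
    then have "NECS (interleave r (?g(m := {UNIV})))" using Suc by (simp only: Suc_leD)
    moreover have "is_split\<^sup>*\<^sup>* {UNIV} (f m)"
      using assms(2)[of m] Suc.prems by (simp add: NECS_def res_class_0_1)
    ultimately have "NECS (interleave r (?g(m := f m)))"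
      using Suc.prems by (intro NECS_interleave_splits[of "{UNIV}" "f m"]) simp_all
    moreover have "?g(m := f m) = (\<lambda>i. if i < Suc m then f i else {UNIV})"
      by (rule ext) (simp add: less_Suc_eq)
    ultimately show ?case by simp
  qed
  from this[of r] show ?thesis by (simp cong: interleave_cong)
qed

lemma NECS_iff_natural: "NECS C \<longleftrightarrow> natural C"
proof
  assume "natural C"
  then show "NECS C" by induction (auto intro: NECS_UNIV NECS_interleave)
qed (rule NECS_imp_natural)

lemma natural_props:
  assumes "natural C"
  shows "finite C" "C \<noteq> {}" "{} \<notin> C"
proof -
  show "finite C" "C \<noteq> {}" using assms by (auto simp: NECS_iff_natural[symmetric] NECS_def ECS_def)
  show "{} \<notin> C" using natural_res_class[OF assms] by (force simp: res_class_eq_range)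
qed

section \<open>Decomposability is a divisibility condition\<close>

text \<open>The case \<open>r = 1\<close> is allowed and gives exactly the natural systems; it
  accounts for the divisor 1 of the gcd.\<close>

definition decomp :: "nat \<Rightarrow> int set set \<Rightarrow> bool" where
  "decomp r C \<longleftrightarrow> (\<exists>f. (\<forall>j<r. natural (f j)) \<and> C = interleave r f)"

text \<open>For a system of residue classes this is the greatest common divisor of the moduli.\<close>

definition step_gcd :: "int set set \<Rightarrow> int" where
  "step_gcd C = Gcd {x - y |x y c. c \<in> C \<and> x \<in> c \<and> y \<in> c}"

lemma dvd_step_gcd_iff: "r dvd step_gcd C \<longleftrightarrow> (\<forall>c\<in>C. \<forall>x\<in>c. \<forall>y\<in>c. r dvd x - y)"
  unfolding step_gcd_def dvd_Gcd_iff by blast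

lemma step_gcd_dvd_diff: "c \<in> C \<Longrightarrow> x \<in> c \<Longrightarrow> y \<in> c \<Longrightarrow> step_gcd C dvd x - y"
  unfolding step_gcd_def by (rule Gcd_dvd) blast

lemma step_gcd_nonneg: "step_gcd C \<ge> 0"
  by (simp add: step_gcd_def)

text \<open>A nonzero gcd has only finitely many divisors, as the Moebius sum requires. It is
  nonzero because a class modulo \<open>n\<close> contains two elements that differ by
  \<open>n\<close>.\<close>

lemma step_gcd_nonzero:
  assumes "natural C"
  shows "step_gcd C \<noteq> 0"
proof
  assume "step_gcd C = 0"
  moreover obtain c where "c \<in> C" using natural_props[OF assms] by blast
  moreover obtain a n where "1 \<le> n" "c = res_class a n"
    using natural_res_class[OF assms \<open>c \<in> C\<close>] by blast
  moreover have "a \<in> res_class a n" "a + n \<in> res_class a n" by (auto simp: res_class_def)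
  ultimately show False using dvd_step_gcd_iff[of 0 C] by fastforce
qed

lemma decomp_imp_dvd: "decomp r C \<Longrightarrow> int r dvd step_gcd C"
  unfolding dvd_step_gcd_iff
  by (auto simp: decomp_def interleave_def rescale_def simp flip: right_diff_distrib)

text \<open>If \<open>r\<close> divides every modulus of an \<open>s\<close>-fold interleaving, then \<open>r / gcd r s\<close> divides the
  moduli of its parts, so by induction the system is an interleaving of \<open>lcm r s\<close> natural systems,
  which can be regrouped modulo \<open>r\<close>.\<close>

lemma dvd_imp_decomp:
  assumes "natural C" "1 \<le> r" "int r dvd step_gcd C"
  shows "decomp r C"
  using assms
proof (induction arbitrary: r)
  case natural_UNIV
  then have "int r dvd 1 - 0"
    by (intro dvd_trans[OF natural_UNIV(2) step_gcd_dvd_diff[of UNIV]]) simp_all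
  then have "r = 1" by simp
  then show ?case
    using natural.natural_UNIV interleave_1[of "\<lambda>_. {UNIV}"]
    by (auto simp: decomp_def intro!: exI[of _ "\<lambda>_. {UNIV}"])
next
  case (natural_interleave s f)
  \<comment> \<open>The cofactors \<open>t\<close> and \<open>u\<close> of \<open>r\<close> and
    \<open>s\<close> are coprime, and \<open>s * t = r * u\<close> is the lcm of \<open>r\<close>
    and \<open>s\<close>.\<close>
  define d where "d = gcd r s"
  define t where "t = r div d"
  define u where "u = s div d"
  have d: "d > 0" using natural_interleave.prems by (simp add: d_def)
  have r: "r = d * t" and s: "s = d * u" by (simp_all add: d_def t_def u_def)
  have pos: "t > 0" "u > 0" using natural_interleave.prems natural_interleave.hyps r s
    by (auto intro!: Nat.gr0I)
  have cop: "coprime t u"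
    using natural_interleave.prems unfolding t_def u_def d_def by (intro div_gcd_coprime) auto
  have "decomp t (f j)" if j: "j < s" for j
  proof (rule natural_interleave.IH[OF j])
    show "int t dvd step_gcd (f j)"
      unfolding dvd_step_gcd_iff
    proof (intro ballI)
      fix c x y assume *: "c \<in> f j" "x \<in> c" "y \<in> c"
      then have "(\<lambda>x. int j + int s * x) ` c \<in> interleave s f"
        using j by (auto simp: interleave_def rescale_def)
      then have "int r dvd (int j + int s * x) - (int j + int s * y)"
        by (rule dvd_trans[OF natural_interleave.prems(2) step_gcd_dvd_diff]) (use * in auto)
      \<comment> \<open>Cancelling \<open>d\<close>, and then \<open>u\<close>, which is coprime to
        \<open>t\<close>, leaves a divisibility condition on the part itself.\<close>
      then have "int d * int t dvd int d * (int u * (x - y))"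
        by (simp add: r s algebra_simps)
      then have "int t dvd int u * (x - y)" using d by simp
      then show "int t dvd x - y" using cop by (simp add: coprime_dvd_mult_right_iff)
    qed
  qed (use pos in simp)
  then have "\<forall>j. \<exists>h. j < s \<longrightarrow> (\<forall>i<t. natural (h i)) \<and> f j = interleave t h"
    unfolding decomp_def by blast
  then obtain h where h: "\<And>j i. j < s \<Longrightarrow> i < t \<Longrightarrow> natural (h j i)"
      "\<And>j. j < s \<Longrightarrow> f j = interleave t (h j)"
    by metis
  define H where "H m = h (m mod s) (m div s)" for m
  have H: "natural (H m)" if "m < s * t" for m
    using that h(1) natural_interleave.hyps(1) unfolding H_def
    by (simp add: less_mult_imp_div_less mult.commute)
  have "interleave s f = interleave s (\<lambda>j. interleave t (h j))"
    using h(2) by (rule interleave_cong)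
  also have "\<dots> = interleave (s * t) H"
    using natural_interleave.hyps(1) by (simp add: interleave_interleave H_def[abs_def])
  also have "s * t = r * u" by (simp add: r s)
  \<comment> \<open>Writing the index through its remainder and quotient by \<open>r\<close> gives
    the right-hand side of \<open>interleave_interleave\<close>, which is then read
    backwards.\<close>
  also have "interleave (r * u) H = interleave (r * u) (\<lambda>m. H (m mod r + r * (m div r)))"
    by simp
  also have "\<dots> = interleave r (\<lambda>j. interleave u (\<lambda>i. H (j + r * i)))"
    using natural_interleave.prems by (intro interleave_interleave[symmetric]) simp
  finally have "interleave s f = interleave r (\<lambda>j. interleave u (\<lambda>i. H (j + r * i)))" .
  moreover have "natural (interleave u (\<lambda>i. H (j + r * i)))" if "j < r" for j
  proof (intro natural_interleave' H)
    fix i assume "i < u"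
    have "j + r * i < r * Suc i" using that by simp
    also have "\<dots> \<le> r * u" using \<open>i < u\<close> by (intro mult_le_mono2) simp
    finally show "j + r * i < s * t" by (simp add: r s mult.commute mult.left_commute)
  qed (use pos in simp)
  ultimately show ?case
    unfolding decomp_def by (intro exI[of _ "\<lambda>j. interleave u (\<lambda>i. H (j + r * i))"]) simp
qed

text \<open>The class \<open>UNIV\<close> contains 0 and 1, which forces gcd 1. An interleaving of
  \<open>r >= 2\<close> natural systems has a gcd divisible by \<open>r\<close>.\<close>

lemma step_gcd_eq_1_iff:
  assumes "natural C"
  shows "step_gcd C = 1 \<longleftrightarrow> C = {UNIV}"
proof
  assume "C = {UNIV}"
  moreover have "step_gcd {UNIV} dvd 1 - 0" by (rule step_gcd_dvd_diff[of UNIV]) auto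
  ultimately show "step_gcd C = 1" using step_gcd_nonneg[of C] by simp
next
  assume *: "step_gcd C = 1"
  from assms show "C = {UNIV}"
  proof cases
    case (natural_interleave r f)
    then have "int r dvd step_gcd C" by (intro decomp_imp_dvd) (auto simp: decomp_def)
    then show ?thesis using * natural_interleave by simp
  qed
qed

text \<open>Each part is nonempty and contributes at least one class. Thus only
  \<open>r <= k\<close> can occur for systems of size \<open>k\<close>.\<close>

lemma decomp_le_card:
  assumes "decomp r C"
  shows "r \<le> card C"
proof -
  obtain f where f: "\<And>j. j < r \<Longrightarrow> natural (f j)" "C = interleave r f"
    using assms by (auto simp: decomp_def)
  have "(\<Sum>j<r. 1) \<le> (\<Sum>j<r. card (f j))"
    using natural_props[OF f(1)] by (intro sum_mono) (simp add: Suc_leI card_gt_0_iff)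
  then show ?thesis using f natural_props[OF f(1)] by (simp add: card_interleave)
qed

section \<open>Powers of the counting series\<close>

definition natural_sys :: "nat \<Rightarrow> int set set set" where
  "natural_sys k = {C. natural C \<and> card C = k}"

lemma finite_natural_sys: "finite (natural_sys k)"
  by (rule finite_subset[OF _ finite_NECS[of k]]) (auto simp: natural_sys_def NECS_iff_natural)

lemma A_fps_nth: "fps_nth A_fps k = of_nat (card (natural_sys k))"
proof -
  \<comment> \<open>The constant term of \<open>A_fps\<close> is set to 0 by definition; this agrees
    with the count, since natural systems are nonempty.\<close>
  have "natural_sys 0 = {}" using natural_props(1,2) by (force simp: natural_sys_def)
  moreover have "num_NECS k = card (natural_sys k)"
    by (simp add: num_NECS_def natural_sys_def NECS_iff_natural)
  ultimately show ?thesis by (simp add: A_fps_def)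
qed

text \<open>A coefficient of the power is a sum over the ways to write \<open>k\<close> as an
  ordered sum of \<open>r\<close> sizes. Interleaving is a bijection from the tuples of natural
  systems with such sizes onto the decomposable systems of size \<open>k\<close>.\<close>

lemma A_fps_power_nth:
  assumes "1 \<le> r"
  shows "fps_nth (A_fps ^ r :: 'a::comm_ring_1 fps) k =
    of_nat (card {C \<in> natural_sys k. decomp r C})"
proof -
  let ?B = "\<lambda>v. Pi\<^sub>E {..<r} (\<lambda>i. natural_sys (v ! i))"
  have disj: "?B v \<inter> ?B w = {}" if "v \<in> natpermute k r" "w \<in> natpermute k r" "v \<noteq> w" for v w
  proof (rule ccontr)
    assume "?B v \<inter> ?B w \<noteq> {}"
    then obtain f where "f \<in> ?B v" "f \<in> ?B w" by blast
    then have "v ! i = w ! i" if "i < r" for i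
      using that by (auto simp: PiE_iff natural_sys_def)
    then show False using that by (auto simp: natpermute_def list_eq_iff_nth_eq)
  qed
  have nat: "\<forall>j<r. natural (f j)" if "f \<in> (\<Union>v\<in>natpermute k r. ?B v)" for f
    using that by (auto simp: PiE_iff natural_sys_def)
  have bij: "bij_betw (interleave r) (\<Union>v\<in>natpermute k r. ?B v) {C \<in> natural_sys k. decomp r C}"
    unfolding bij_betw_def
  proof
    show "inj_on (interleave r) (\<Union>v\<in>natpermute k r. ?B v)"
    proof (rule inj_onI)
      fix f g assume *: "f \<in> (\<Union>v\<in>natpermute k r. ?B v)" "g \<in> (\<Union>v\<in>natpermute k r. ?B v)"
        "interleave r f = interleave r g"
      have "f j = g j" if "j < r" for j
        using nat[OF *(1)] nat[OF *(2)] *(3) that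
        by (intro interleave_inject[of r f g]) (auto dest: natural_props(3))
      \<comment> \<open>An interleaving determines its parts below \<open>r\<close> only;
        extensionality settles the other arguments.\<close>
      moreover have "f \<in> extensional {..<r}" "g \<in> extensional {..<r}"
        using * by (auto simp: PiE_iff)
      ultimately show "f = g" by (intro extensionalityI) auto
    qed
    show "interleave r ` (\<Union>v\<in>natpermute k r. ?B v) = {C \<in> natural_sys k. decomp r C}"
    proof (intro equalityI subsetI)
      fix C assume "C \<in> interleave r ` (\<Union>v\<in>natpermute k r. ?B v)"
      then obtain f v where f: "C = interleave r f" "v \<in> natpermute k r" "f \<in> ?B v" by blast
      then have n: "\<And>j. j < r \<Longrightarrow> natural (f j)" using nat by blast
      have "card C = (\<Sum>j<r. card (f j))"
        using f(1) n natural_props by (simp add: card_interleave)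
      also have "\<dots> = (\<Sum>j<r. v ! j)"
        using f(3) by (intro sum.cong refl) (auto simp: PiE_iff natural_sys_def)
      also have "\<dots> = k"
        using f(2) by (auto simp: natpermute_def sum_list_sum_nth lessThan_atLeast0)
      finally show "C \<in> {C \<in> natural_sys k. decomp r C}"
        using f(1) n assms by (auto simp: natural_sys_def decomp_def intro: natural_interleave')
    next
      fix C assume C: "C \<in> {C \<in> natural_sys k. decomp r C}"
      then obtain f where f: "\<And>j. j < r \<Longrightarrow> natural (f j)" "C = interleave r f"
        by (auto simp: decomp_def)
      define v where "v = map (\<lambda>j. card (f j)) [0..<r]"
      have "card C = (\<Sum>j<r. card (f j))"
        using f natural_props by (simp add: card_interleave)
      then have "v \<in> natpermute k r"
        using C by (auto simp: v_def natpermute_def natural_sys_def sum_list_sum_nth lessThan_atLeast0)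
      moreover have "restrict f {..<r} \<in> ?B v"
        using f(1) by (auto simp: v_def natural_sys_def)
      moreover have "C = interleave r (restrict f {..<r})"
        unfolding f(2) by (rule interleave_cong) simp
      ultimately show "C \<in> interleave r ` (\<Union>v\<in>natpermute k r. ?B v)" by blast
    qed
  qed
  have fin: "finite (?B v)" for v
    by (intro finite_PiE) (auto intro: finite_natural_sys)
  have "card {C \<in> natural_sys k. decomp r C} = card (\<Union>v\<in>natpermute k r. ?B v)"
    using bij_betw_same_card[OF bij] by simp
  also have "\<dots> = (\<Sum>v\<in>natpermute k r. card (?B v))"
    using disj fin by (intro card_UN_disjoint) (auto intro: natpermute_finite)
  also have "\<dots> = (\<Sum>v\<in>natpermute k r. \<Prod>j<r. card (natural_sys (v ! j)))"
    by (simp add: card_PiE)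
  finally have "of_nat (card {C \<in> natural_sys k. decomp r C}) =
      (\<Sum>v\<in>natpermute k r. \<Prod>j<r. fps_nth (A_fps :: 'a fps) (v ! j))"
    by (simp add: A_fps_nth)
  moreover have "{0..r - 1} = {..<r}" using assms by auto
  ultimately show ?thesis using assms by (simp add: fps_power_nth)
qed

section \<open>The functional equation and its uniqueness\<close>

text \<open>A new prime factor preserves squarefreeness, or its failure, and changes the parity of
  the number of prime factors.\<close>

lemma moebius_mu_prime_mult:
  assumes "prime p" "\<not> p dvd d"
  shows "moebius_mu (p * d) = - moebius_mu d"
proof -
  have "coprime p d" using assms by (simp add: prime_imp_coprime)
  then have sq: "squarefree (p * d) \<longleftrightarrow> squarefree d"
    using assms squarefree_mult_coprime squarefree_prime squarefree_multD(2) by metis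
  have "d \<noteq> 0" using assms by (intro notI) simp
  then have "prime_factors (p * d) = insert p (prime_factors d)"
    using assms by (auto simp: prime_factors_product prime_prime_factors)
  moreover have "p \<notin> prime_factors d" using assms by auto
  ultimately show ?thesis by (simp add: moebius_mu_def sq)
qed

text \<open>For a prime \<open>p\<close> dividing \<open>n\<close>, the squarefree divisors of
  \<open>n\<close> fall into pairs \<open>d\<close>, \<open>p * d\<close> with \<open>d\<close> not
  divisible by \<open>p\<close>, and the two terms of a pair cancel.\<close>

lemma sum_moebius_mu_divisors:
  assumes "n > 0"
  shows "(\<Sum>d | d dvd n. moebius_mu d) = (if n = 1 then 1 else 0)"
proof (cases "n = 1")
  case True
  then show ?thesis by (simp add: moebius_mu_def)
next
  case False
  then obtain p where p: "prime p" "p dvd n" using prime_factor_nat by blast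
  define S where "S = {d. d dvd n \<and> \<not> p dvd d \<and> squarefree d}"
  have fin: "finite {d. d dvd n}" using assms by simp
  then have finS: "finite S" by (rule rev_finite_subset) (auto simp: S_def)
  have "(\<Sum>d | d dvd n. moebius_mu d) = (\<Sum>d\<in>S \<union> (*) p ` S. moebius_mu d)"
  proof (rule sum.mono_neutral_right[OF fin])
    show "S \<union> (*) p ` S \<subseteq> {d. d dvd n}"
      using p by (auto simp: S_def prime_imp_coprime intro!: divides_mult)
    show "\<forall>d\<in>{d. d dvd n} - (S \<union> (*) p ` S). moebius_mu d = 0"
    proof
      fix d assume d: "d \<in> {d. d dvd n} - (S \<union> (*) p ` S)"
      have "\<not> squarefree d"
      proof
        assume sq: "squarefree d"
        then have "p dvd d" using d by (auto simp: S_def)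
        then obtain e where e: "d = p * e" ..
        have "\<not> p dvd e"
        proof
          assume "p dvd e"
          then have "p ^ 2 dvd d" by (auto simp: e power2_eq_square)
          then show False using sq p(1) by (auto dest: squarefreeD)
        qed
        moreover have "squarefree e" using sq squarefree_multD(2) e by blast
        moreover have "e dvd n" using d e by (auto intro: dvd_mult_right)
        ultimately show False using d e by (auto simp: S_def)
      qed
      then show "moebius_mu d = 0" by (simp add: moebius_mu_def)
    qed
  qed
  also have "\<dots> = sum moebius_mu S + sum moebius_mu ((*) p ` S)"
    using finS by (intro sum.union_disjoint) (auto simp: S_def)
  also have "sum moebius_mu ((*) p ` S) = (\<Sum>d\<in>S. moebius_mu (p * d))"
    using p(1) by (subst sum.reindex) (auto simp: inj_on_def)
  also have "\<dots> = (\<Sum>d\<in>S. - moebius_mu d)"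
    by (intro sum.cong refl moebius_mu_prime_mult) (use p in \<open>auto simp: S_def\<close>)
  finally show ?thesis using False by (simp add: sum_negf)
qed

text \<open>The indices are exactly the divisors of the gcd \<open>g\<close>: for
  \<open>r >= 1\<close> decomposability means divisibility, and the bound \<open>k\<close> excludes
  no \<open>r\<close>, since \<open>r\<close> parts need at least \<open>r\<close> classes.\<close>

lemma sum_moebius_mu_decomp:
  assumes "C \<in> natural_sys k"
  shows "(\<Sum>r | r \<in> {1..k} \<and> decomp r C. moebius_mu r) = (if C = {UNIV} then 1 else 0)"
proof -
  have C: "natural C" "card C = k" using assms by (auto simp: natural_sys_def)
  have eq: "C = {UNIV} \<longleftrightarrow> step_gcd C = 1" using step_gcd_eq_1_iff[OF C(1)] by (rule sym)
  define g where "g = nat (step_gcd C)"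
  have g: "int g = step_gcd C" "g > 0"
    using step_gcd_nonneg[of C] step_gcd_nonzero[OF C(1)] by (auto simp: g_def)
  have "r \<in> {1..k} \<and> decomp r C \<longleftrightarrow> r dvd g" for r
  proof
    assume "r \<in> {1..k} \<and> decomp r C"
    then show "r dvd g" using decomp_imp_dvd[of r C] by (simp flip: g(1))
  next
    assume r: "r dvd g"
    then have "r \<ge> 1" using g(2) by (auto intro!: Suc_leI Nat.gr0I)
    moreover from this have "decomp r C"
      using r dvd_imp_decomp[OF C(1)] by (simp flip: g(1))
    ultimately show "r \<in> {1..k} \<and> decomp r C" using decomp_le_card C(2) by auto
  qed
  then show ?thesis
    unfolding eq using sum_moebius_mu_divisors[OF g(2)] by (simp flip: g(1))
qed

lemma M_fps_compose_A_fps: "fps_compose M_fps A_fps = (fps_X :: 'a::comm_ring_1 fps)"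
proof (rule fps_ext)
  fix k
  have "fps_nth (fps_compose M_fps A_fps :: 'a fps) k =
      (\<Sum>r=1..k. fps_nth M_fps r * fps_nth (A_fps ^ r) k)"
    unfolding fps_compose_nth by (rule sum.mono_neutral_right) (auto simp: M_fps_def)
  also have "\<dots> = (\<Sum>r=1..k. of_int (\<Sum>C\<in>natural_sys k. if decomp r C then moebius_mu r else 0))"
    by (intro sum.cong refl)
      (simp add: M_fps_def A_fps_power_nth sum.If_cases finite_natural_sys Int_def mult.commute)
  \<comment> \<open>Exchanging the sums isolates, for each system, the Moebius sum over its possible
    numbers of parts.\<close>
  also have "\<dots> = of_int (\<Sum>C\<in>natural_sys k. \<Sum>r=1..k. if decomp r C then moebius_mu r else 0)"
    by (subst sum.swap) simp
  also have "(\<Sum>C\<in>natural_sys k. \<Sum>r=1..k. if decomp r C then moebius_mu r else 0) =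
      (\<Sum>C\<in>natural_sys k. \<Sum>r | r \<in> {1..k} \<and> decomp r C. moebius_mu r)"
    by (intro sum.cong refl sum.inter_filter[symmetric]) simp
  also have "\<dots> = (\<Sum>C\<in>natural_sys k. if C = {UNIV} then 1 else 0)"
    by (intro sum.cong refl sum_moebius_mu_decomp)
  also have "\<dots> = (if k = 1 then 1 else 0)"
  proof -
    have "{UNIV} \<in> natural_sys k \<longleftrightarrow> k = 1" using natural_UNIV by (auto simp: natural_sys_def)
    then show ?thesis by (simp add: finite_natural_sys)
  qed
  finally show "fps_nth (fps_compose M_fps A_fps :: 'a fps) k = fps_nth fps_X k" by simp
qed

text \<open>At the first index \<open>d\<close> where \<open>F\<close> and \<open>G\<close> differ,
  their powers with exponent at least 2 still agree. So the compositions differ there by the linear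
  coefficient of \<open>M\<close> times a nonzero element.\<close>

lemma fps_compose_cancel_left:
  fixes M F G :: "'a::idom fps"
  assumes "fps_nth M 1 \<noteq> 0" "fps_nth F 0 = 0" "fps_nth G 0 = 0"
    and eq: "fps_compose M F = fps_compose M G"
  shows "F = G"
proof (rule ccontr)
  assume "F \<noteq> G"
  define d where "d = subdegree (F - G)"
  have low: "fps_nth (F - G) i = 0" if "i < d" for i
    using that unfolding d_def by (rule nth_less_subdegree_zero)
  have nz: "fps_nth (F - G) d \<noteq> 0" using \<open>F \<noteq> G\<close>
    unfolding d_def by (intro nth_subdegree_nonzero) simp
  then have "d \<ge> 1" using assms(2,3) by (cases d) auto
  have pow: "fps_nth (F ^ i) d - fps_nth (G ^ i) d = (if i = 1 then fps_nth (F - G) d else 0)" for i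
  proof (cases "i \<le> 1")
    case True
    then show ?thesis by (cases i) auto
  next
    case False
    \<comment> \<open>This is the cofactor of \<open>F - G\<close> in \<open>F ^ i - G ^ i\<close>.
      For \<open>i >= 2\<close> each term contains a positive power of \<open>F\<close> or
      \<open>G\<close>, so the constant term is 0.\<close>
    define S where "S = (\<Sum>j<i. G ^ (i - Suc j) * F ^ j)"
    have "fps_nth S 0 = 0"
      unfolding S_def fps_sum_nth
    proof (intro sum.neutral ballI)
      fix j assume "j \<in> {..<i}"
      then have "i - Suc j > 0 \<or> j > 0" using False by auto
      then show "fps_nth (G ^ (i - Suc j) * F ^ j) 0 = 0" using assms(2,3) by auto
    qed
    have "fps_nth (F ^ i) d - fps_nth (G ^ i) d = fps_nth ((F - G) * S) d"
      by (simp add: S_def power_diff_sumr2 flip: fps_sub_nth)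
    also have "\<dots> = (\<Sum>j=0..d. fps_nth (F - G) j * fps_nth S (d - j))"
      by (rule fps_mult_nth)
    \<comment> \<open>For \<open>j < d\<close> the factor from \<open>F - G\<close> vanishes; for
      \<open>j = d\<close> the other factor is the constant term of \<open>S\<close>.\<close>
    also have "\<dots> = 0"
      using low \<open>fps_nth S 0 = 0\<close> by (intro sum.neutral) (metis atLeastAtMost_iff diff_self_eq_0
        le_neq_implies_less mult_zero_left mult_zero_right)
    finally show ?thesis using False by simp
  qed
  have "0 = fps_nth (fps_compose M F) d - fps_nth (fps_compose M G) d" using eq by simp
  also have "\<dots> = (\<Sum>i=0..d. fps_nth M i * (fps_nth (F ^ i) d - fps_nth (G ^ i) d))"
    by (simp add: fps_compose_nth right_diff_distrib sum_subtractf)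
  also have "\<dots> = (\<Sum>i=0..d. if i = 1 then fps_nth M 1 * fps_nth (F - G) d else 0)"
    by (intro sum.cong refl) (simp only: pow, simp)
  also have "\<dots> = fps_nth M 1 * fps_nth (F - G) d" using \<open>d \<ge> 1\<close> by simp
  finally show False using nz assms(1) by simp
qed

theorem theorem1:
  shows "fps_nth (A_fps :: 'a::{idom, ring_char_0} fps) 0 = 0 \<and>
         fps_compose M_fps (A_fps :: 'a fps) = fps_X \<and>
         (\<forall>F :: 'a fps. fps_nth F 0 = 0 \<and> fps_compose M_fps F = fps_X \<longrightarrow> F = A_fps)"
proof (intro conjI allI impI)
  show A0: "fps_nth (A_fps :: 'a fps) 0 = 0" by (simp add: A_fps_def)
  show "fps_compose M_fps (A_fps :: 'a fps) = fps_X" by (rule M_fps_compose_A_fps)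
  fix F :: "'a fps" assume F: "fps_nth F 0 = 0 \<and> fps_compose M_fps F = fps_X"
  have "fps_nth (M_fps :: 'a fps) 1 \<noteq> 0" by (simp add: M_fps_def moebius_mu_def)
  then show "F = A_fps"
    by (rule fps_compose_cancel_left) (use F A0 in \<open>simp_all only: M_fps_compose_A_fps\<close>)
qed

end
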